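(* Let $n\geq 1$ and $d\geq 2$ be integers and let $f=\sum_{i=1}^n x_i^d\in\mathbb{C}[x_1,\ldots,x_n]_d$. (i) If $d\geq n+1$, then $\dim(\mathrm{Ker}(dH_f))=n-1$. (ii) If $d\leq n$, then $\dim(\mathrm{Ker}(dH_f))=n-1+\binom{n}{d}$.
   Context: $\mathbb{C}[x_1,\ldots,x_n]_d$ is the complex vector space of homogeneous polynomials of degree $d$ (including $0$). The Hessian map $H:\mathbb{C}[x_1,\ldots,x_n]_d\to\mathbb{C}[x_1,\ldots,x_n]_{n(d-2)}$ is $H(g)=\det\left(\frac{\partial^2 g}{\partial x_i\partial x_j}\right)_{1\le i,j\le n}$. Its differential at $f$ is the linear map $dH_f:\mathbb{C}[x_1,\ldots,x_n]_d\to\mathbb{C}[x_1,\ldots,x_n]_{n(d-2)}$, $g\mapsto\frac{d}{dt}H(f+tg)|_{t=0}$. Dimensions are over $\mathbb{C}$. *)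

theory Defs
  imports
    "HOL-Analysis.Analysis"
    "HOL-Library.Poly_Mapping"
    "HOL-Computational_Algebra.Polynomial"
begin

text \<open>
  Polynomials over the complex numbers in variables indexed by a finite type \<open>'n\<close> (so the number
  of variables is \<open>CARD('n)\<close>): finitely supported maps from exponent vectors to coefficients,
  with the convolution product of \<open>HOL-Library.Poly_Mapping\<close>.
\<close>

type_synonym 'n cmpoly = "('n \<Rightarrow>\<^sub>0 nat) \<Rightarrow>\<^sub>0 complex"

definition Var :: "'n \<Rightarrow> 'n cmpoly" where
  "Var i = Poly_Mapping.single (Poly_Mapping.single i 1) 1"

definition cscale :: "complex \<Rightarrow> 'n cmpoly \<Rightarrow> 'n cmpoly" where
  "cscale c p = Poly_Mapping.map ((*) c) p"

lemma cscale_conv_mult: "cscale c p = Poly_Mapping.single 0 c * p"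
  by (simp add: cscale_def mult_map_scale_conv_mult)

lemma lookup_cscale [simp]: "Poly_Mapping.lookup (cscale c p) m = c * Poly_Mapping.lookup p m"
  by (simp add: cscale_def Poly_Mapping.map.rep_eq when_def)

global_interpretation cmpoly: vector_space "cscale :: complex \<Rightarrow> 'n cmpoly \<Rightarrow> 'n cmpoly"
  by unfold_locales
    (auto simp: poly_mapping_eq_iff fun_eq_iff lookup_add algebra_simps)

definition homogeneous_polys :: "nat \<Rightarrow> 'n::finite cmpoly set" where
  "homogeneous_polys d = {p. \<forall>m\<in>Poly_Mapping.keys p. (\<Sum>i\<in>UNIV. Poly_Mapping.lookup m i) = d}"

text \<open>
  The truncated subtraction of exponents is harmless: if \<open>i\<close> does not occur in the monomial
  \<open>m\<close>, the coefficient is 0.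
\<close>

definition pdiff :: "'n \<Rightarrow> 'n cmpoly \<Rightarrow> 'n cmpoly" where
  "pdiff i p = (\<Sum>m\<in>Poly_Mapping.keys p. Poly_Mapping.single (m - Poly_Mapping.single i 1)
     (of_nat (Poly_Mapping.lookup m i) * Poly_Mapping.lookup p m))"

definition hessian :: "'n::finite cmpoly \<Rightarrow> 'n cmpoly" where
  "hessian g = det (\<chi> i j. pdiff i (pdiff j g))"

text \<open>
  The derivative of a polynomial-valued function of \<open>t\<close> is taken coefficientwise; that every
  coefficient is differentiable and that the result has finite support is shown in
  \<open>has_field_derivative_hessian\<close> below.
\<close>

definition dhessian :: "'n::finite cmpoly \<Rightarrow> 'n cmpoly \<Rightarrow> 'n cmpoly" where
  "dhessian f g = Poly_Mapping.Abs_poly_mapping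
     (\<lambda>m. deriv (\<lambda>t. Poly_Mapping.lookup (hessian (f + cscale t g)) m) 0)"

definition ker_dhessian :: "nat \<Rightarrow> 'n::finite cmpoly \<Rightarrow> 'n cmpoly set" where
  "ker_dhessian d f = {g \<in> homogeneous_polys d. dhessian f g = 0}"

lemma pdiff_superset:
  assumes "finite A" "Poly_Mapping.keys p \<subseteq> A"
  shows "pdiff i p = (\<Sum>m\<in>A. Poly_Mapping.single (m - Poly_Mapping.single i 1)
     (of_nat (Poly_Mapping.lookup m i) * Poly_Mapping.lookup p m))"
  unfolding pdiff_def using assms
  by (intro sum.mono_neutral_left) (auto simp: in_keys_iff)

lemma pdiff_add_cscale: "pdiff i (p + cscale c q) = pdiff i p + cscale c (pdiff i q)"
proof -
  define A where "A = Poly_Mapping.keys p \<union> Poly_Mapping.keys q"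
  have fin: "finite A" by (simp add: A_def)
  have sub: "Poly_Mapping.keys (p + cscale c q) \<subseteq> A" "Poly_Mapping.keys p \<subseteq> A" "Poly_Mapping.keys q \<subseteq> A"
    by (auto simp: A_def in_keys_iff lookup_add)
  show ?thesis
    unfolding sub[THEN pdiff_superset[OF fin]] cmpoly.scale_sum_right sum.distrib[symmetric]
    by (intro sum.cong refl poly_mapping_eqI)
       (auto simp: lookup_add lookup_single when_def algebra_simps)
qed

lemma hessian_pencil_polynomial:
  obtains P :: "('n::finite cmpoly) poly"
  where "\<And>t. hessian (f + cscale t g) = poly P (Poly_Mapping.single 0 t)"
proof
  define M where "M i j = [:pdiff i (pdiff j f), pdiff i (pdiff j g):]" for i j :: 'n
  show "hessian (f + cscale t g) =
      poly (\<Sum>p\<in>{p. p permutes UNIV}. of_int (sign p) * (\<Prod>i\<in>UNIV. M i (p i))) (Poly_Mapping.single 0 t)" for t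
    by (simp add: hessian_def det_def poly_sum poly_prod M_def pdiff_add_cscale flip: cscale_conv_mult)
qed

lemma has_field_derivative_hessian:
  fixes f g :: "'n::finite cmpoly"
  shows "((\<lambda>t. Poly_Mapping.lookup (hessian (f + cscale t g)) m)
     has_field_derivative Poly_Mapping.lookup (dhessian f g) m) (at 0)"
proof -
  obtain P where P: "\<And>t. hessian (f + cscale t g) = poly P (Poly_Mapping.single 0 t)"
    using hessian_pencil_polynomial[of f g] by blast
  have pow: "Poly_Mapping.single 0 t ^ k = (Poly_Mapping.single 0 (t ^ k) :: 'n cmpoly)" for t k
    by (induction k) (simp_all add: mult_single)
  define q where "q m = Poly (map (\<lambda>k. Poly_Mapping.lookup (coeff P k) m) [0..<Suc (degree P)])" for m
  have cq: "coeff (q m) k = Poly_Mapping.lookup (coeff P k) m" for m k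
    by (auto simp: q_def nth_default_def coeff_eq_0 simp del: upt_Suc)
  have dq: "degree (q m) \<le> degree P" for m
    by (intro degree_le) (auto simp: cq coeff_eq_0)
  have qsum: "poly (q m) t = (\<Sum>k\<le>degree P. coeff (q m) k * t ^ k)" for m t
    unfolding poly_altdef using dq[of m]
    by (intro sum.mono_neutral_left) (auto simp: coeff_eq_0)
  have lk: "Poly_Mapping.lookup (hessian (f + cscale t g)) m = poly (q m) t" for t m
    unfolding P poly_altdef[of P] qsum lookup_sum
    by (intro sum.cong refl) (simp add: cq pow mult.commute[of "coeff P _"] flip: cscale_conv_mult)
  have der: "((\<lambda>t. Poly_Mapping.lookup (hessian (f + cscale t g)) m)
      has_field_derivative Poly_Mapping.lookup (coeff P 1) m) (at 0)" for m
    unfolding lk using poly_DERIV[of "q m" 0] by (simp add: poly_0_coeff_0 coeff_pderiv cq)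
  have "dhessian f g = coeff P 1"
    unfolding dhessian_def DERIV_imp_deriv[OF der] by simp
  with der show ?thesis by simp
qed

end

theory Submission
  imports Defs
begin

text \<open>
  The Hessian matrix of \<open>f = \<Sum>\<^sub>i x\<^sub>i^d\<close> is diagonal with entries \<open>d (d - 1) x\<^sub>i^(d - 2)\<close>.  To first
  order in \<open>t\<close>, the determinant of a diagonal matrix perturbed by \<open>t B\<close> only sees the diagonal of
  \<open>B\<close>: a permutation other than the identity moves at least two points, so that its product contains two
  off-diagonal factors and is divisible by \<open>t^2\<close> (\<open>dhessian_diagonal\<close>).  Hence, up to a nonzero
  constant, \<open>dH\<^sub>f(g) = \<Sum>\<^sub>i g\<^sub>i\<^sub>i \<Prod>\<^sub>j\<^sub>\<noteq>\<^sub>i x\<^sub>j^(d - 2)\<close>.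

  A monomial \<open>c x^m\<close> of \<open>g\<close> contributes to the \<open>i\<close>-th summand the coefficient
  \<open>m\<^sub>i (m\<^sub>i - 1) c\<close> at the exponent \<open>m - d e\<^sub>i + (d - 2) (1, \<dots>, 1)\<close>.  Two contributions
  \<open>(m, i)\<close> and \<open>(m', i')\<close> with \<open>i \<noteq> i'\<close> share their exponent only if
  \<open>m - m' = d e\<^sub>i - d e\<^sub>i\<^sub>'\<close>, which in degree \<open>d\<close> forces \<open>m = d e\<^sub>i\<close> and \<open>m' = d e\<^sub>i\<^sub>'\<close>.  So the
  pure powers \<open>x\<^sub>i^d\<close> all contribute to one and the same coefficient, and give the single
  condition that their coefficients in \<open>g\<close> add up to zero, whereas every other contribution stands
  alone and has to vanish.  The latter says that a monomial which is not a pure power must be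
  squarefree (\<open>ker_dhessian_Fermat_iff\<close>).

  The kernel is therefore the direct sum of the hyperplane of coefficient sum zero in the span of
  the \<open>n\<close> pure powers and of the span of the \<open>n choose d\<close> squarefree monomials of degree \<open>d\<close>,
  so its dimension is \<open>n - 1 + (n choose d)\<close> for every \<open>d \<ge> 2\<close>
  (\<open>dim_ker_dhessian_Fermat\<close>).  Both claims are instances, as the binomial coefficient vanishes
  for \<open>d > n\<close>.
\<close>

section \<open>Second derivatives of monomials\<close>

lemma pdiff_add: "pdiff i (p + q) = pdiff i p + pdiff i q"
  using pdiff_add_cscale[of i p 1 q] by simp

lemma pdiff_zero: "pdiff i 0 = 0"
  by (simp add: pdiff_def)

lemma pdiff_sum: "pdiff i (\<Sum>a\<in>A. p a) = (\<Sum>a\<in>A. pdiff i (p a))"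
  by (induction A rule: infinite_finite_induct) (simp_all add: pdiff_zero pdiff_add)

lemma pdiff_single:
  "pdiff i (Poly_Mapping.single m c) =
     Poly_Mapping.single (m - Poly_Mapping.single i 1) (of_nat (Poly_Mapping.lookup m i) * c)"
  using pdiff_superset[of "{m}" "Poly_Mapping.single m c" i] by simp

lemma sum_single_keys:
  "(\<Sum>m\<in>Poly_Mapping.keys p. Poly_Mapping.single m (Poly_Mapping.lookup p m)) = p"
  by (rule poly_mapping_eqI)
     (simp add: lookup_sum lookup_single when_def in_keys_iff)

lemma pdiff_twice:
  "pdiff i (pdiff i p) = (\<Sum>m\<in>Poly_Mapping.keys p. Poly_Mapping.single (m - Poly_Mapping.single i 2)
     (of_nat (Poly_Mapping.lookup m i * (Poly_Mapping.lookup m i - 1)) * Poly_Mapping.lookup p m))"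
proof -
  have "m - Poly_Mapping.single i 1 - Poly_Mapping.single i 1 = m - Poly_Mapping.single i 2"
    for m :: "'a \<Rightarrow>\<^sub>0 nat"
    by (rule poly_mapping_eqI) (simp add: lookup_minus lookup_single when_def numeral_2_eq_2)
  then show ?thesis
    by (simp add: pdiff_def[of i p] pdiff_sum pdiff_single lookup_minus lookup_single mult_ac del: diff_diff_eq)
qed

lemma Var_power: "Var i ^ d = Poly_Mapping.single (Poly_Mapping.single i d) 1"
  by (induction d) (simp_all add: Var_def mult_single flip: single_add)

lemma pdiff_pdiff_Var_power:
  "pdiff i (pdiff j (Var k ^ d)) =
     (if i = k \<and> j = k then Poly_Mapping.single (Poly_Mapping.single k (d - 2)) (of_nat (d * (d - 1))) else 0)"
proof -
  have "Poly_Mapping.single k d - Poly_Mapping.single k 1 - Poly_Mapping.single k 1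
      = Poly_Mapping.single k (d - 2)"
    by (rule poly_mapping_eqI) (simp add: lookup_minus lookup_single when_def numeral_2_eq_2)
  then show ?thesis
    by (auto simp: Var_power pdiff_single lookup_minus lookup_single when_def mult.commute)
qed

section \<open>The differential at a polynomial with diagonal Hessian\<close>

text \<open>
  The differential is defined by derivatives of single coefficients; this turns it into a purely
  algebraic quantity, the linear coefficient of any polynomial in \<open>t\<close> that represents the Hessian
  along the line \<open>f + t g\<close>.
\<close>

lemma dhessian_eq_coeff_1:
  assumes P: "\<And>t. hessian (f + cscale t g) = poly P (Poly_Mapping.single 0 t)"
  shows "dhessian f g = coeff P 1"
proof (rule poly_mapping_eqI)
  fix m
  have pow: "Poly_Mapping.single 0 t ^ k = (Poly_Mapping.single 0 (t ^ k) :: 'a cmpoly)" for t k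
    by (induction k) (simp_all add: mult_single)
  \<comment> \<open>The sum runs one step beyond the degree so that the index 1 occurs in it even if \<open>P\<close> is
    constant.\<close>
  have lk: "Poly_Mapping.lookup (hessian (f + cscale t g)) m
      = (\<Sum>k\<le>Suc (degree P). Poly_Mapping.lookup (coeff P k) m * t ^ k)" for t
  proof -
    have "hessian (f + cscale t g) = (\<Sum>k\<le>Suc (degree P). coeff P k * Poly_Mapping.single 0 t ^ k)"
      unfolding P poly_altdef by (simp add: coeff_eq_0)
    then show ?thesis
      by (simp add: lookup_sum lookup_add pow mult.commute[of "coeff P _"] mult.commute[of "Poly_Mapping.lookup _ _"]
               flip: cscale_conv_mult)
  qed
  have "((\<lambda>t. Poly_Mapping.lookup (hessian (f + cscale t g)) m) has_field_derivative
      (\<Sum>k\<le>Suc (degree P). Poly_Mapping.lookup (coeff P k) m * (of_nat k * 0 ^ (k - 1)))) (at 0)"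
    unfolding lk by (intro DERIV_sum) (auto intro!: derivative_eq_intros)
  also have "(\<Sum>k\<le>Suc (degree P). Poly_Mapping.lookup (coeff P k) m * (of_nat k * 0 ^ (k - 1)))
      = (\<Sum>k\<in>{1}. Poly_Mapping.lookup (coeff P k) m * (of_nat k * 0 ^ (k - 1)))"
    by (rule sum.mono_neutral_right) auto
  finally show "Poly_Mapping.lookup (dhessian f g) m = Poly_Mapping.lookup (coeff P 1) m"
    using has_field_derivative_hessian[of f g m] by (auto dest: DERIV_unique)
qed

text \<open>
  This is the product rule at \<open>t = 0\<close>; reading off a coefficient instead of differentiating makes
  it meaningful over coefficients with zero divisors.
\<close>

lemma coeff_1_prod_linear:
  fixes a b :: "'i \<Rightarrow> 'a::comm_semiring_1"
  assumes "finite A"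
  shows "coeff (\<Prod>i\<in>A. [:a i, b i:]) 1 = (\<Sum>i\<in>A. b i * (\<Prod>j\<in>A - {i}. a j))"
  using assms
proof (induction A rule: finite_induct)
  case (insert x A)
  have c0: "coeff (\<Prod>i\<in>A. [:a i, b i:]) 0 = (\<Prod>i\<in>A. a i)"
    by (simp add: poly_prod flip: poly_0_coeff_0)
  have "(\<Prod>j\<in>insert x A - {i}. a j) = a x * (\<Prod>j\<in>A - {i}. a j)" if "i \<in> A" for i
  proof -
    have "insert x A - {i} = insert x (A - {i})" using insert.hyps that by auto
    then show ?thesis using insert.hyps by simp
  qed
  moreover have "insert x A - {x} = A" using insert.hyps by auto
  ultimately show ?case
    using insert by (simp add: c0 sum_distrib_left algebra_simps)
qed simp

text \<open>
  Expanding the determinant over permutations \<open>p\<close>, the linear coefficient of each product replaces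
  one factor of \<open>\<Prod>\<^sub>i A\<^sub>i\<^sub>p\<^sub>(\<^sub>i\<^sub>)\<close> by a second derivative of \<open>g\<close>.  If \<open>p\<close> is not the identity, an
  off-diagonal second derivative of \<open>f\<close> remains among the other factors.
\<close>

lemma dhessian_diagonal:
  fixes f g :: "'n::finite cmpoly"
  assumes diag: "\<And>i j. i \<noteq> j \<Longrightarrow> pdiff i (pdiff j f) = 0"
  shows "dhessian f g = (\<Sum>i\<in>UNIV. pdiff i (pdiff i g) * (\<Prod>j\<in>UNIV - {i}. pdiff j (pdiff j f)))"
proof -
  let ?A = "\<lambda>i j. pdiff i (pdiff j f)" and ?B = "\<lambda>i j. pdiff i (pdiff j g)"
  define T where "T p = (\<Sum>i\<in>UNIV. ?B i (p i) * (\<Prod>j\<in>UNIV - {i}. ?A j (p j)))" for p :: "'n \<Rightarrow> 'n"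
  define P where "P = (\<Sum>p\<in>{p. p permutes UNIV}. smult (of_int (sign p))
                        (\<Prod>i\<in>UNIV. [:?A i (p i), ?B i (p i):]))"
  have "hessian (f + cscale t g) = poly P (Poly_Mapping.single 0 t)" for t
    by (simp add: hessian_def det_def P_def poly_sum poly_prod pdiff_add_cscale flip: cscale_conv_mult)
  then have "dhessian f g = coeff P 1"
    by (rule dhessian_eq_coeff_1)
  also have "\<dots> = (\<Sum>p\<in>{p. p permutes (UNIV::'n set)}. of_int (sign p) * T p)"
    unfolding P_def coeff_sum coeff_smult T_def by (subst coeff_1_prod_linear) simp_all
  also have "\<dots> = (\<Sum>p\<in>{id}. of_int (sign p) * T p)"
  proof (rule sum.mono_neutral_right)
    show "\<forall>p\<in>{p. p permutes UNIV} - {id}. of_int (sign p) * T p = 0"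
    proof
      fix p :: "'n \<Rightarrow> 'n"
      assume p: "p \<in> {p. p permutes UNIV} - {id}"
      have "(\<Prod>j\<in>UNIV - {i}. ?A j (p j)) = 0" for i
      proof -
        \<comment> \<open>A permutation that moves some point moves at least two, hence one other than \<open>i\<close>.\<close>
        have "\<exists>j. j \<noteq> i \<and> p j \<noteq> j"
        proof (rule ccontr)
          assume "\<nexists>j. j \<noteq> i \<and> p j \<noteq> j"
          then have fixed: "p j = j" if "j \<noteq> i" for j using that by blast
          have "inj p" using p by (auto simp: permutes_inj)
          then have "p i = i" using fixed by (metis injD)
          then have "p = id" using fixed by (metis eq_id_iff)
          with p show False by simp
        qed
        then obtain j where "j \<noteq> i" "p j \<noteq> j" by blast
        then show ?thesis by (intro prod_zero) (auto intro!: bexI[of _ j] simp: diag)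
      qed
      then show "of_int (sign p) * T p = 0" by (simp add: T_def)
    qed
  qed (auto simp: permutes_id)
  finally show ?thesis by (simp add: T_def sign_id)
qed

section \<open>The kernel in terms of coefficients\<close>

text \<open>
  Here \<open>m - 2 e\<^sub>i + \<Sum>\<^sub>j\<^sub>\<noteq>\<^sub>i (d - 2) e\<^sub>j\<close> is the exponent \<open>m - d e\<^sub>i + (d - 2) (1, \<dots>, 1)\<close>, written so that
  the truncated subtraction only loses information when \<open>m\<^sub>i \<le> 1\<close>, where the coefficient is
  zero.
\<close>

lemma dhessian_Fermat:
  fixes g :: "'n::finite cmpoly"
  assumes f: "f = (\<Sum>i\<in>UNIV. Var i ^ d)"
  shows "dhessian f g = (\<Sum>i\<in>UNIV. \<Sum>m\<in>Poly_Mapping.keys g.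
     Poly_Mapping.single (m - Poly_Mapping.single i 2 + (\<Sum>j\<in>UNIV - {i}. Poly_Mapping.single j (d - 2)))
       (of_nat (d * (d - 1)) ^ (CARD('n) - 1) *
        of_nat (Poly_Mapping.lookup m i * (Poly_Mapping.lookup m i - 1)) * Poly_Mapping.lookup g m))"
proof -
  have H: "pdiff i (pdiff j f) =
      (if i = j then Poly_Mapping.single (Poly_Mapping.single i (d - 2)) (of_nat (d * (d - 1))) else 0)" for i j
    unfolding f pdiff_sum pdiff_pdiff_Var_power
    by (cases "i = j") (auto intro!: sum.neutral)
  have prod: "(\<Prod>j\<in>A. Poly_Mapping.single (e j) c) = (Poly_Mapping.single (\<Sum>j\<in>A. e j) (c ^ card A) :: 'n cmpoly)"
    if "finite A" for A :: "'n set" and e c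
    using that by (induction A rule: finite_induct) (simp_all add: mult_single)
  have "dhessian f g = (\<Sum>i\<in>UNIV. pdiff i (pdiff i g) *
      (\<Prod>j\<in>UNIV - {i}. pdiff j (pdiff j f)))"
    by (rule dhessian_diagonal) (simp add: H)
  also have "\<dots> = (\<Sum>i\<in>UNIV. pdiff i (pdiff i g) *
      Poly_Mapping.single (\<Sum>j\<in>UNIV - {i}. Poly_Mapping.single j (d - 2)) (of_nat (d * (d - 1)) ^ (CARD('n) - 1)))"
    by (simp only: H prod finite if_True refl card_Diff_singleton UNIV_I)
  finally show ?thesis
    by (simp only: pdiff_twice sum_distrib_right mult_single mult.commute mult.left_commute mult.assoc)
qed

lemma homogeneous_pure_power:
  assumes "g \<in> homogeneous_polys d" "m \<in> Poly_Mapping.keys g" "Poly_Mapping.lookup m i \<ge> d"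
  shows "m = Poly_Mapping.single i d"
proof (rule poly_mapping_eqI)
  fix j
  have d: "(\<Sum>k\<in>UNIV. Poly_Mapping.lookup m k) = d"
    using assms by (auto simp: homogeneous_polys_def)
  have "(\<Sum>k\<in>UNIV. Poly_Mapping.lookup m k) = Poly_Mapping.lookup m i + (\<Sum>k\<in>UNIV - {i}. Poly_Mapping.lookup m k)"
    by (simp add: sum.remove)
  with d assms(3) have "Poly_Mapping.lookup m i = d" "(\<Sum>k\<in>UNIV - {i}. Poly_Mapping.lookup m k) = 0"
    by linarith+
  then show "Poly_Mapping.lookup m j = Poly_Mapping.lookup (Poly_Mapping.single i d) j"
    by (auto simp: lookup_single when_def)
qed

text \<open>
  The contributions of \<open>dhessian_Fermat\<close> are sorted by their exponent \<open>e i m\<close>.  The pure powers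
  \<open>x\<^sub>i^d\<close>, differentiated in \<open>x\<^sub>i\<close>, are exactly the monomials whose nonzero contributions land on
  \<open>z = (d - 2) (1, \<dots>, 1)\<close>; away from them the exponent determines
  the pair \<open>(i, m)\<close>, so no cancellation can occur.
\<close>

lemma ker_dhessian_Fermat_iff:
  fixes g :: "'n::finite cmpoly"
  assumes f: "f = (\<Sum>i\<in>UNIV. Var i ^ d)" and d: "d \<ge> 2"
  shows "g \<in> ker_dhessian d f \<longleftrightarrow> g \<in> homogeneous_polys d \<and>
     (\<forall>m\<in>Poly_Mapping.keys g. (\<exists>i. m = Poly_Mapping.single i d) \<or> (\<forall>i. Poly_Mapping.lookup m i \<le> 1)) \<and>
     (\<Sum>i\<in>UNIV. Poly_Mapping.lookup g (Poly_Mapping.single i d)) = 0"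
proof (cases "g \<in> homogeneous_polys d")
  case hom: True
  define e where "e i m = m - Poly_Mapping.single i 2 + (\<Sum>j\<in>UNIV - {i}. Poly_Mapping.single j (d - 2))"
    for i :: 'n and m :: "'n \<Rightarrow>\<^sub>0 nat"
  define C where "C = (of_nat (d * (d - 1)) :: complex) ^ (CARD('n) - 1)"
  define w where "w i m = C * of_nat (Poly_Mapping.lookup m i * (Poly_Mapping.lookup m i - 1)) * Poly_Mapping.lookup g m"
    for i :: 'n and m :: "'n \<Rightarrow>\<^sub>0 nat"
  have C: "C \<noteq> 0" using d by (simp add: C_def)
  have dh: "dhessian f g = (\<Sum>i\<in>UNIV. \<Sum>m\<in>Poly_Mapping.keys g. Poly_Mapping.single (e i m) (w i m))"
    unfolding dhessian_Fermat[OF f] e_def w_def C_def ..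
  have lookup_dh: "Poly_Mapping.lookup (dhessian f g) u =
      (\<Sum>i\<in>UNIV. \<Sum>m\<in>Poly_Mapping.keys g. w i m when e i m = u)" for u
    unfolding dh lookup_sum lookup_single ..
  have lookup_e: "Poly_Mapping.lookup (e i m) k =
      (if k = i then Poly_Mapping.lookup m k - 2 else Poly_Mapping.lookup m k + (d - 2))" for i k m
    by (auto simp: e_def lookup_add lookup_minus lookup_sum lookup_single when_def)
  have w0: "w i m = 0" if "Poly_Mapping.lookup m i \<le> 1" for i m
    using that by (cases "Poly_Mapping.lookup m i") (auto simp: w_def)
  have w_pos: "w i m \<noteq> 0" if "Poly_Mapping.lookup m i \<ge> 2" "m \<in> Poly_Mapping.keys g" for i m
    using that C by (auto simp: w_def in_keys_iff simp del: of_nat_mult)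
  define z where "z = (\<Sum>j\<in>(UNIV::'n set). Poly_Mapping.single j (d - 2))"
  have lookup_z: "Poly_Mapping.lookup z k = d - 2" for k
    by (simp add: z_def lookup_sum lookup_single when_def)
  have e_pure: "e i (Poly_Mapping.single i d) = z" for i
    by (rule poly_mapping_eqI) (auto simp: lookup_e lookup_z lookup_single when_def)
  have w_pure: "w i (Poly_Mapping.single i d)
      = C * of_nat (d * (d - 1)) * Poly_Mapping.lookup g (Poly_Mapping.single i d)" for i
    by (simp add: w_def)
  have pure_part: "(\<Sum>m\<in>Poly_Mapping.keys g. w i m when m = Poly_Mapping.single i d) =
      C * of_nat (d * (d - 1)) * Poly_Mapping.lookup g (Poly_Mapping.single i d)" for i
    by (auto simp: when_def w_pure in_keys_iff)
  have dh_z: "Poly_Mapping.lookup (dhessian f g) z =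
      C * of_nat (d * (d - 1)) * (\<Sum>i\<in>UNIV. Poly_Mapping.lookup g (Poly_Mapping.single i d))"
  proof -
    have "(w i m when e i m = z) = (w i m when m = Poly_Mapping.single i d)"
      if m: "m \<in> Poly_Mapping.keys g" for i m
    proof (cases "Poly_Mapping.lookup m i \<ge> 2")
      case True
      have "e i m = z \<longleftrightarrow> m = Poly_Mapping.single i d"
      proof
        assume "e i m = z"
        then have "Poly_Mapping.lookup m i - 2 = d - 2"
          using lookup_e[of i m i] lookup_z[of i] by simp
        with True d show "m = Poly_Mapping.single i d"
          by (intro homogeneous_pure_power[OF hom m]) simp
      qed (simp only: e_pure)
      then show ?thesis by (simp only:)
    qed (simp add: w0)
    then show ?thesis
      unfolding lookup_dh sum_distrib_left pure_part[symmetric] by (intro sum.cong refl)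
  qed
  have c0: "C * of_nat (d * (d - 1)) \<noteq> 0" using C d by simp
  \<comment> \<open>If \<open>i' \<noteq> i\<close>, comparing exponents at \<open>i\<close> gives \<open>m' i + (d - 2) = m i - 2\<close>, hence
    \<open>m i \<ge> d\<close>, and \<open>m\<close> would be a pure power.\<close>
  have e_inj: "i' = i \<and> m' = m" if eq: "e i' m' = e i m" and m: "m \<in> Poly_Mapping.keys g"
    and ge: "Poly_Mapping.lookup m i \<ge> 2" "Poly_Mapping.lookup m' i' \<ge> 2"
    and np: "m \<noteq> Poly_Mapping.single i d" for i i' m m'
  proof -
    have eq': "Poly_Mapping.lookup (e i' m') k = Poly_Mapping.lookup (e i m) k" for k
      using eq by simp
    have lt: "Poly_Mapping.lookup m i < d"
      using homogeneous_pure_power[OF hom m, of i] np by force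
    have i: "i' = i"
      using eq'[of i] lt ge by (auto simp: lookup_e split: if_splits)
    have "Poly_Mapping.lookup m' k = Poly_Mapping.lookup m k" for k
      using eq'[of k] ge by (auto simp: lookup_e i split: if_splits)
    with i show ?thesis by (auto intro: poly_mapping_eqI)
  qed
  show ?thesis
  proof
    assume "g \<in> ker_dhessian d f"
    then have 0: "dhessian f g = 0" by (simp add: ker_dhessian_def)
    have "(\<exists>i. m = Poly_Mapping.single i d) \<or> (\<forall>i. Poly_Mapping.lookup m i \<le> 1)"
      if m: "m \<in> Poly_Mapping.keys g" for m
    proof (rule ccontr)
      assume "\<not> ?thesis"
      then obtain i where np: "m \<noteq> Poly_Mapping.single i d" and i: "Poly_Mapping.lookup m i \<ge> 2"
        by (metis not_less_eq_eq numeral_2_eq_2 One_nat_def)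
      have "(w i' m' when e i' m' = e i m) = (w i m when i' = i \<and> m' = m)" for i' m'
        using e_inj[of i' m' i m] m i np w0[of m' i'] by (cases "Poly_Mapping.lookup m' i' \<ge> 2") (auto simp: when_def)
      then have "Poly_Mapping.lookup (dhessian f g) (e i m) =
          (\<Sum>i'\<in>UNIV. \<Sum>m'\<in>Poly_Mapping.keys g. w i m when i' = i \<and> m' = m)"
        unfolding lookup_dh by simp
      also have "\<dots> = (\<Sum>i'\<in>UNIV. if i' = i then w i m else 0)"
        using m by (intro sum.cong refl) (auto simp: when_def)
      also have "\<dots> = w i m" by simp
      finally show False using 0 w_pos[OF i m] by simp
    qed
    moreover have "(\<Sum>i\<in>UNIV. Poly_Mapping.lookup g (Poly_Mapping.single i d)) = 0"
      using dh_z c0 0 by simp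
    ultimately show "g \<in> homogeneous_polys d \<and>
     (\<forall>m\<in>Poly_Mapping.keys g. (\<exists>i. m = Poly_Mapping.single i d) \<or> (\<forall>i. Poly_Mapping.lookup m i \<le> 1)) \<and>
     (\<Sum>i\<in>UNIV. Poly_Mapping.lookup g (Poly_Mapping.single i d)) = 0"
      using hom by blast
  next
    assume R: "g \<in> homogeneous_polys d \<and>
     (\<forall>m\<in>Poly_Mapping.keys g. (\<exists>i. m = Poly_Mapping.single i d) \<or> (\<forall>i. Poly_Mapping.lookup m i \<le> 1)) \<and>
     (\<Sum>i\<in>UNIV. Poly_Mapping.lookup g (Poly_Mapping.single i d)) = 0"
    have "Poly_Mapping.lookup (dhessian f g) u = 0" for u
    proof (cases "u = z")
      case False
      have "(w i m when e i m = u) = 0" if m: "m \<in> Poly_Mapping.keys g" for i m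
      proof (cases "Poly_Mapping.lookup m i \<ge> 2")
        case True
        then have "\<not> Poly_Mapping.lookup m i \<le> 1" by simp
        with R m obtain j where j: "m = Poly_Mapping.single j d" by blast
        with True have "j = i" by (auto simp: lookup_single when_def split: if_splits)
        then show ?thesis using False j e_pure by (auto simp: when_def)
      qed (simp add: w0)
      then show ?thesis unfolding lookup_dh by simp
    qed (use dh_z R in simp)
    then have "dhessian f g = 0" by (intro poly_mapping_eqI) simp
    with hom show "g \<in> ker_dhessian d f" by (simp add: ker_dhessian_def)
  qed
qed (simp add: ker_dhessian_def)

section \<open>A basis of the kernel\<close>

text \<open>
  Taking the coefficient at each exponent in \<open>I\<close> gives linear functionals dual to the family
  \<open>b\<close>.
\<close>

lemma independent_dual_coefficients:
  fixes b :: "('n \<Rightarrow>\<^sub>0 nat) \<Rightarrow> 'n cmpoly"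
  assumes "finite I"
    and dual: "\<And>m m'. m \<in> I \<Longrightarrow> m' \<in> I \<Longrightarrow> Poly_Mapping.lookup (b m) m' = (if m = m' then 1 else 0)"
  shows "inj_on b I" and "cmpoly.independent (b ` I)"
proof -
  show inj: "inj_on b I"
    by (rule inj_onI) (metis dual one_neq_zero)
  show "cmpoly.independent (b ` I)"
  proof (rule cmpoly.independent_if_scalars_zero)
    fix c x
    assume 0: "(\<Sum>x\<in>b ` I. cscale (c x) x) = 0" and "x \<in> b ` I"
    then obtain m where m: "m \<in> I" "x = b m" by blast
    have "0 = Poly_Mapping.lookup (\<Sum>k\<in>I. cscale (c (b k)) (b k)) m"
      using 0 inj by (simp add: sum.reindex)
    also have "\<dots> = (\<Sum>k\<in>I. if k = m then c (b k) else 0)"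
      unfolding lookup_sum using m by (intro sum.cong) (simp_all add: dual)
    also have "\<dots> = c x" using m assms(1) by simp
    finally show "c x = 0" by simp
  qed (simp add: assms)
qed

definition squarefree_monomial :: "'n::finite set \<Rightarrow> 'n \<Rightarrow>\<^sub>0 nat" where
  "squarefree_monomial S = (\<Sum>i\<in>S. Poly_Mapping.single i 1)"

lemma lookup_squarefree_monomial:
  "Poly_Mapping.lookup (squarefree_monomial S) i = (if i \<in> S then 1 else 0)"
  by (simp add: squarefree_monomial_def lookup_sum lookup_single when_def)

lemma inj_squarefree_monomial: "inj squarefree_monomial"
  by (rule injI) (metis lookup_squarefree_monomial one_neq_zero set_eqI)

lemma squarefree_monomialE:
  assumes "\<And>i. Poly_Mapping.lookup m i \<le> 1"
  obtains S where "m = squarefree_monomial S" "card S = (\<Sum>i\<in>UNIV. Poly_Mapping.lookup m i)"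
proof
  let ?S = "{i. Poly_Mapping.lookup m i = 1}"
  show m: "m = squarefree_monomial ?S"
  proof (rule poly_mapping_eqI)
    show "Poly_Mapping.lookup m i = Poly_Mapping.lookup (squarefree_monomial ?S) i" for i
      using assms[of i] by (auto simp: lookup_squarefree_monomial le_Suc_eq)
  qed
  have "(\<Sum>i\<in>UNIV. Poly_Mapping.lookup m i) = (\<Sum>i\<in>UNIV. if i \<in> ?S then 1 else 0)"
    by (subst m) (simp add: lookup_squarefree_monomial)
  then show "card ?S = (\<Sum>i\<in>UNIV. Poly_Mapping.lookup m i)"
    by (simp add: sum.If_cases)
qed

text \<open>
  Fix a variable \<open>i0\<close>.  The polynomials \<open>x\<^sub>i^d - x\<^sub>i\<^sub>0^d\<close> for \<open>i \<noteq> i0\<close> and the squarefree monomials of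
  degree \<open>d\<close> form a basis of the kernel.  It is indexed by the exponents \<open>R \<union> Q\<close>, which leave out
  the exponent of \<open>x\<^sub>i\<^sub>0^d\<close>, so that reading off coefficients at \<open>R \<union> Q\<close> yields the dual basis; the
  coefficient at \<open>x\<^sub>i\<^sub>0^d\<close> is then determined by the sum condition.
\<close>

lemma dim_ker_dhessian_Fermat:
  fixes f :: "'n::finite cmpoly"
  assumes f: "f = (\<Sum>i\<in>UNIV. Var i ^ d)" and d: "d \<ge> 2"
  shows "cmpoly.dim (ker_dhessian d f) = CARD('n) - 1 + (CARD('n) choose d)"
proof -
  obtain i0 :: 'n where True by blast
  let ?x = "\<lambda>i::'n. Poly_Mapping.single i d"
  define Q where "Q = squarefree_monomial ` {S::'n set. card S = d}"
  define R where "R = ?x ` (UNIV - {i0})"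
  define b :: "('n \<Rightarrow>\<^sub>0 nat) \<Rightarrow> 'n cmpoly"
    where "b m = Poly_Mapping.single m 1 - (if m \<in> R then Poly_Mapping.single (?x i0) 1 else 0)" for m
  have inj: "inj ?x"
  proof (rule injI)
    fix i j
    assume "?x i = ?x j"
    then have "Poly_Mapping.lookup (?x i) i = Poly_Mapping.lookup (?x j) i" by simp
    with d show "i = j" by (simp add: lookup_single when_def split: if_splits)
  qed
  have x_notin_Q: "?x i \<notin> Q" for i
  proof
    assume "?x i \<in> Q"
    then obtain S where "?x i = squarefree_monomial S" by (auto simp: Q_def)
    then have "Poly_Mapping.lookup (?x i) i = Poly_Mapping.lookup (squarefree_monomial S) i" by simp
    with d show False by (simp add: lookup_squarefree_monomial split: if_splits)
  qed
  have x0: "?x i0 \<notin> R \<union> Q" using x_notin_Q inj by (auto simp: R_def dest: injD)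
  have disj: "R \<inter> Q = {}" using x_notin_Q by (auto simp: R_def)
  have fin: "finite R" "finite Q" by (auto simp: R_def Q_def)
  have cardR: "card R = CARD('n) - 1"
    unfolding R_def by (subst card_image) (auto intro: inj_on_subset[OF inj] simp: card_Diff_singleton)
  have cardQ: "card Q = CARD('n) choose d"
    unfolding Q_def using n_subsets[of "UNIV :: 'n set" d]
    by (subst card_image) (auto intro: inj_on_subset[OF inj_squarefree_monomial])
  have lookup_b: "Poly_Mapping.lookup (b m) m' =
      (if m = m' then 1 else 0) - (if m \<in> R \<and> m' = ?x i0 then 1 else 0)" for m m'
    by (auto simp: b_def lookup_minus lookup_single when_def)
  have dual: "Poly_Mapping.lookup (b m) m' = (if m = m' then 1 else 0)"
    if "m \<in> R \<union> Q" "m' \<in> R \<union> Q" for m m'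
    using that x0 by (auto simp: lookup_b)
  have sum_x: "(\<Sum>i\<in>UNIV. h (?x i)) = h (?x i0) + (\<Sum>m\<in>R. h m)" for h :: "_ \<Rightarrow> complex"
  proof -
    have "(\<Sum>m\<in>R. h m) = (\<Sum>i\<in>UNIV - {i0}. h (?x i))"
      unfolding R_def by (subst sum.reindex) (auto intro: inj_on_subset[OF inj])
    then show ?thesis by (simp add: sum.remove[of UNIV i0])
  qed
  have degR: "(\<Sum>i\<in>UNIV. Poly_Mapping.lookup (?x k) i) = d" for k
    by (simp add: lookup_single when_def)
  have degQ: "(\<Sum>i\<in>UNIV. Poly_Mapping.lookup m i) = d \<and> (\<forall>i. Poly_Mapping.lookup m i \<le> 1)" if "m \<in> Q" for m
    using that by (auto simp: Q_def lookup_squarefree_monomial sum.If_cases)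
  have b_ker: "b m \<in> ker_dhessian d f" if m: "m \<in> R \<union> Q" for m
  proof -
    have keys: "u = m \<or> (m \<in> R \<and> u = ?x i0)" if "u \<in> Poly_Mapping.keys (b m)" for u
      using that by (auto simp: in_keys_iff lookup_b split: if_splits)
    have deg: "(\<Sum>i\<in>UNIV. Poly_Mapping.lookup m i) = d"
      using m degQ degR by (auto simp: R_def)
    have "b m \<in> homogeneous_polys d"
      unfolding homogeneous_polys_def using keys deg degR by blast
    moreover have "(\<exists>i. u = ?x i) \<or> (\<forall>i. Poly_Mapping.lookup u i \<le> 1)"
      if "u \<in> Poly_Mapping.keys (b m)" for u
      using keys[OF that] m degQ[of m] by (auto simp: R_def)
    moreover have "(\<Sum>i\<in>UNIV. Poly_Mapping.lookup (b m) (?x i)) = 0"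
    proof -
      have "(\<Sum>u\<in>R. Poly_Mapping.lookup (b m) u) = (\<Sum>u\<in>R. if m = u then 1 else 0)"
        using m by (intro sum.cong) (auto simp: dual)
      then show ?thesis
        unfolding sum_x using fin x0 m by (auto simp: lookup_b)
    qed
    ultimately show ?thesis unfolding ker_dhessian_Fermat_iff[OF f d] by blast
  qed
  have span: "g \<in> cmpoly.span (b ` (R \<union> Q))" if "g \<in> ker_dhessian d f" for g
  proof -
    from that have hom: "g \<in> homogeneous_polys d"
      and supp: "\<And>m. m \<in> Poly_Mapping.keys g \<Longrightarrow> (\<exists>i. m = ?x i) \<or> (\<forall>i. Poly_Mapping.lookup m i \<le> 1)"
      and zero: "(\<Sum>i\<in>UNIV. Poly_Mapping.lookup g (?x i)) = 0"
      unfolding ker_dhessian_Fermat_iff[OF f d] by blast+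
    have keys: "m \<in> R \<union> Q \<or> m = ?x i0" if m: "m \<in> Poly_Mapping.keys g" for m
      using supp[OF m]
    proof
      assume "\<forall>i. Poly_Mapping.lookup m i \<le> 1"
      then obtain S where "m = squarefree_monomial S" "card S = (\<Sum>i\<in>UNIV. Poly_Mapping.lookup m i)"
        by (metis squarefree_monomialE)
      with hom m show ?thesis by (auto simp: Q_def homogeneous_polys_def)
    qed (auto simp: R_def)
    have "g = (\<Sum>m\<in>R \<union> Q. cscale (Poly_Mapping.lookup g m) (b m))"
    proof (rule poly_mapping_eqI)
      fix u
      have rhs: "Poly_Mapping.lookup (\<Sum>m\<in>R \<union> Q. cscale (Poly_Mapping.lookup g m) (b m)) u
          = (\<Sum>m\<in>R \<union> Q. Poly_Mapping.lookup g m * Poly_Mapping.lookup (b m) u)"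
        by (simp add: lookup_sum)
      consider "u \<in> R \<union> Q" | "u = ?x i0" | "u \<notin> R \<union> Q" "u \<noteq> ?x i0" by blast
      then show "Poly_Mapping.lookup g u = Poly_Mapping.lookup (\<Sum>m\<in>R \<union> Q. cscale (Poly_Mapping.lookup g m) (b m)) u"
      proof cases
        case 1
        then have "(\<Sum>m\<in>R \<union> Q. Poly_Mapping.lookup g m * Poly_Mapping.lookup (b m) u)
            = (\<Sum>m\<in>R \<union> Q. if m = u then Poly_Mapping.lookup g m else 0)"
          by (intro sum.cong) (auto simp: dual)
        with 1 fin show ?thesis unfolding rhs by simp
      next
        case 2
        have "(\<Sum>m\<in>R \<union> Q. Poly_Mapping.lookup g m * Poly_Mapping.lookup (b m) u)
            = (\<Sum>m\<in>R. - Poly_Mapping.lookup g m)"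
          using x0 disj fin 2 by (intro sum.mono_neutral_cong_right) (auto simp: lookup_b)
        moreover have "Poly_Mapping.lookup g u + (\<Sum>m\<in>R. Poly_Mapping.lookup g m) = 0"
          using zero 2 unfolding sum_x by simp
        ultimately show ?thesis unfolding rhs sum_negf by (metis eq_neg_iff_add_eq_0)
      next
        case 3
        then have "Poly_Mapping.lookup g u = 0" using keys[of u] by (auto simp: in_keys_iff)
        with 3 show ?thesis unfolding rhs
          by (subst sum.neutral) (auto simp: lookup_b)
      qed
    qed
    moreover have "(\<Sum>m\<in>R \<union> Q. cscale (Poly_Mapping.lookup g m) (b m)) \<in> cmpoly.span (b ` (R \<union> Q))"
      by (intro cmpoly.span_sum cmpoly.span_scale cmpoly.span_base imageI)
    ultimately show ?thesis by simp
  qed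
  note ind = independent_dual_coefficients[of "R \<union> Q" b, OF _ dual]
  show ?thesis
  proof (rule cmpoly.dim_unique)
    show "b ` (R \<union> Q) \<subseteq> ker_dhessian d f" using b_ker by blast
    show "ker_dhessian d f \<subseteq> cmpoly.span (b ` (R \<union> Q))" using span by blast
    show "cmpoly.independent (b ` (R \<union> Q))" using ind(2) fin by blast
    show "card (b ` (R \<union> Q)) = CARD('n) - 1 + (CARD('n) choose d)"
      using ind(1) fin disj by (simp add: card_image card_Un_disjoint cardR cardQ)
  qed
qed

theorem proposition3p2:
  fixes f :: "'n::finite cmpoly" and n d :: nat
  assumes "CARD('n) = n" and "d \<ge> 2"
    and "f = (\<Sum>i\<in>UNIV. Var i ^ d)"
  shows "(d \<ge> n + 1 \<longrightarrow> cmpoly.dim (ker_dhessian d f) = n - 1) \<and>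
         (d \<le> n \<longrightarrow> cmpoly.dim (ker_dhessian d f) = n - 1 + (n choose d))"
  using dim_ker_dhessian_Fermat[OF assms(3,2)] assms(1) by (simp add: binomial_eq_0)

end
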